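(* Let $\ell\ge 5$ be an integer. There is no function $f:\mathbb{N}\to\mathbb{N}$ such that for every graph $G$ and every positive integer $k$, either $G$ contains $k+1$ pairwise vertex-disjoint induced cycles each of length at least $\ell$, or there is a set $T\subseteq V(G)$ with $|T|\le f(k)$ such that $G-T$ contains no induced cycle of length at least $\ell$. (That is, the class of cycles of length at least $\ell$ does not have the Erdős–Pósa property under the induced subgraph relation.)
   Context: All graphs are finite, without loops or parallel edges. An induced cycle of $G$ is an induced subgraph of $G$ which is a cycle. *)

theory Defs
  imports "Graph_Theory.Graph_Theory"
begin

text \<open>
  Undirected simple graphs are Graph_Theory's \<^locale>\<open>graph\<close>: finite, loop-free, symmetric digraphs
  without parallel arcs, an edge between u and v being the two arcs from u to v and from v to u.

  The library predicate \<^const>\<open>pre_digraph.cycle\<close> speaks of closed arc walks, not of graphs, and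
  accepts u, v, u (one edge traversed back and forth); hence the bound 3 below. A graph is a cycle of
  length n if some such closed walk of length n uses all its vertices and, up to direction, all
  its edges.
\<close>

definition cycle_graph :: "nat \<Rightarrow> ('a, 'b) pre_digraph \<Rightarrow> bool" where
  "cycle_graph n C \<longleftrightarrow> graph C \<and> 3 \<le> n \<and>
     (\<exists>p. pre_digraph.cycle C p \<and> length p = n \<and>
          verts C = tail C ` set p \<and>
          arcs_ends C = arc_to_ends C ` set p \<union> (arc_to_ends C ` set p)\<inverse>)"

definition long_induced_cycle :: "nat \<Rightarrow> ('a, 'b) pre_digraph \<Rightarrow> ('a, 'b) pre_digraph \<Rightarrow> bool" where
  "long_induced_cycle l G C \<longleftrightarrow> induced_subgraph C G \<and> (\<exists>n\<ge>l. cycle_graph n C)"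

definition delete_verts :: "('a, 'b) pre_digraph \<Rightarrow> 'a set \<Rightarrow> ('a, 'b) pre_digraph" where
  "delete_verts G T = G \<restriction> (verts G - T)"

end

theory Submission
  imports Defs
begin

text \<open>
  Take an independent set of points indexed by the unordered pairs of numbers below n, and for each
  i < n a cycle of length 2n that passes alternately through the points \<open>{i, j}\<close> and through n private
  connector vertices; join any two connectors of different cycles. An induced cycle that uses connectors
  of two different cycles has at most four vertices, because the connectors induce a complete
  multipartite graph and every point has only connectors as neighbours. Hence every induced cycle
  of length at least 5 is one of the n chosen ones. The i-th and the i'-th of these share the point
  \<open>{i, i'}\<close>, so no two are disjoint, but every vertex lies on at most two of them, so a hitting set
  needs at least n/2 vertices. Thus already \<open>k = 1\<close> admits no bound.
\<close>

section \<open>Cycle graphs\<close>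

lemma cas_iff_map: "pre_digraph.cas G u p v \<longleftrightarrow> u # map (head G) p = map (tail G) p @ [v]"
  by (induction p arbitrary: u) (auto simp: pre_digraph.cas.simps)

text \<open>Replaces the recursively defined closed walk by one list equation. Read with
  \<open>nth_rotate1\<close>, it says that the head of the \<open>k\<close>-th arc is the tail of
  the next one, indices taken cyclically.\<close>

lemma (in wf_digraph) cycle_iff_rotate1:
  "cycle p \<longleftrightarrow> p \<noteq> [] \<and> set p \<subseteq> arcs G \<and> map (head G) p = rotate1 (map (tail G) p)
     \<and> distinct (map (tail G) p)"
proof (cases p)
  case Nil
  then show ?thesis by (simp add: cycle_def)
next
  case (Cons e es)
  show ?thesis
  proof
    assume "cycle p"
    then obtain u where u: "set p \<subseteq> arcs G" "cas u p u" "distinct (tl (awalk_verts u p))"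
      unfolding cycle_def awalk_def by blast
    then have "map (head G) p = rotate1 (map (tail G) p)"
      unfolding cas_iff_map by (simp add: Cons)
    moreover have "tl (awalk_verts u p) = map (head G) p"
      using awalk_verts_conv'[OF u(2)] Cons by simp
    ultimately show "p \<noteq> [] \<and> set p \<subseteq> arcs G \<and> map (head G) p = rotate1 (map (tail G) p)
        \<and> distinct (map (tail G) p)"
      using u Cons by (metis distinct1_rotate list.distinct(1))
  next
    assume R: "p \<noteq> [] \<and> set p \<subseteq> arcs G \<and> map (head G) p = rotate1 (map (tail G) p)
        \<and> distinct (map (tail G) p)"
    then have cas: "cas (tail G e) p (tail G e)"
      unfolding cas_iff_map by (simp add: Cons)
    then have "tl (awalk_verts (tail G e) p) = map (head G) p"
      using awalk_verts_conv' R by simp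
    then have "distinct (tl (awalk_verts (tail G e) p))"
      using R by (metis distinct1_rotate)
    with cas show "cycle p"
      using R Cons by (auto simp: cycle_def awalk_def)
  qed
qed

text \<open>Lets a cycle be given by a cyclic enumeration \<open>c\<close> of its vertices, with no
  mention of walks or arcs.\<close>

lemma cycle_graphI:
  assumes C: "graph C" and m: "3 \<le> m" and inj: "inj_on c {..<m}"
    and V: "verts C = c ` {..<m}"
    and step: "\<And>k. k < m \<Longrightarrow> (c k, c (Suc k mod m)) \<in> arcs_ends C"
    and only: "\<And>u v. (u, v) \<in> arcs_ends C \<Longrightarrow> \<exists>k<m. {u, v} = {c k, c (Suc k mod m)}"
  shows "cycle_graph m C"
proof -
  interpret graph C by fact
  \<comment> \<open>\<open>step\<close> only provides end pairs, while a closed walk is a list of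
    arcs, so an arc is chosen for each pair.\<close>
  define e where "e k = (SOME a. a \<in> arcs C \<and> tail C a = c k \<and> head C a = c (Suc k mod m))" for k
  have e: "e k \<in> arcs C \<and> tail C (e k) = c k \<and> head C (e k) = c (Suc k mod m)" if "k < m" for k
    unfolding e_def using step[OF that] by - (rule someI_ex, auto simp: arcs_ends_conv)
  define p where "p = map e [0..<m]"
  have tails: "map (tail C) p = map c [0..<m]"
    using e by (simp add: p_def)
  have "map (head C) p = rotate1 (map (tail C) p)"
  proof (rule nth_equalityI)
    fix k assume "k < length (map (head C) p)"
    then show "map (head C) p ! k = rotate1 (map (tail C) p) ! k"
      unfolding tails using e by (simp add: p_def nth_rotate1)
  qed simp
  moreover have "distinct (map (tail C) p)"
    unfolding tails using inj by (simp add: distinct_map atLeast0LessThan)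
  moreover have "set p \<subseteq> arcs C" "p \<noteq> []"
    using e m by (auto simp: p_def)
  ultimately have "cycle p"
    by (simp add: cycle_iff_rotate1)
  moreover have "verts C = tail C ` set p"
    using e by (simp add: V p_def image_image atLeast0LessThan)
  moreover have "arcs_ends C = arc_to_ends C ` set p \<union> (arc_to_ends C ` set p)\<inverse>" (is "_ = ?R")
  proof -
    have P: "arc_to_ends C ` set p = (\<lambda>k. (c k, c (Suc k mod m))) ` {..<m}"
      using e by (simp add: p_def image_image atLeast0LessThan arc_to_ends_def)
    have "?R \<subseteq> arcs_ends C"
      unfolding P using step arcs_ends_symmetric[OF sym_arcs] by auto
    moreover have "arcs_ends C \<subseteq> ?R"
      unfolding P using only by (fastforce simp: doubleton_eq_iff)
    ultimately show ?thesis by blast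
  qed
  ultimately show ?thesis
    using C m unfolding cycle_graph_def by (auto simp: p_def intro!: exI[of _ p])
qed

text \<open>Order and 2-regularity are all that the analysis of long induced cycles uses;
  connectedness is not carried along.\<close>

lemma cycle_graph_two_regular:
  assumes "cycle_graph m C"
  shows "card (verts C) = m"
    and "v \<in> verts C \<Longrightarrow> \<exists>a b. a \<noteq> b \<and> {w. (v, w) \<in> arcs_ends C} = {a, b}"
proof -
  obtain p where C: "graph C" and m: "3 \<le> m" and cyc: "pre_digraph.cycle C p"
    and len: "length p = m" and V: "verts C = tail C ` set p"
    and A: "arcs_ends C = arc_to_ends C ` set p \<union> (arc_to_ends C ` set p)\<inverse>"
    using assms unfolding cycle_graph_def by blast
  interpret graph C by fact
  define c where "c k = tail C (p ! k)" for k
  have rot: "map (head C) p = rotate1 (map (tail C) p)" and dist: "distinct (map (tail C) p)"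
    using cyc unfolding cycle_iff_rotate1 by auto
  have c_eq: "c i = c j \<longleftrightarrow> i = j" if "i < m" "j < m" for i j
    using nth_eq_iff_index_eq[OF dist, of i j] that len by (simp add: c_def)
  have head: "head C (p ! k) = c (Suc k mod m)" if "k < m" for k
  proof -
    have "head C (p ! k) = rotate1 (map (tail C) p) ! k"
      using that len by (simp flip: rot)
    also have "\<dots> = c (Suc k mod m)"
      using that len m by (simp add: nth_rotate1 c_def)
    finally show ?thesis .
  qed
  have set_p: "set p = (!) p ` {..<m}"
    using len by (auto simp: set_conv_nth)
  have P: "arc_to_ends C ` set p = (\<lambda>k. (c k, c (Suc k mod m))) ` {..<m}"
    unfolding set_p image_image using head by (simp add: arc_to_ends_def c_def)
  have Vc: "verts C = c ` {..<m}"
    unfolding V set_p image_image c_def ..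
  show "card (verts C) = m"
    unfolding Vc using c_eq by (subst card_image) (auto intro: inj_onI)
  assume "v \<in> verts C"
  then obtain k where k: "k < m" "v = c k"
    unfolding Vc by blast
  define s where "s = Suc k mod m"
  \<comment> \<open>The cyclic predecessor of \<open>k\<close>; the case split avoids truncated
    subtraction at 0.\<close>
  define r where "r = (if k = 0 then m - 1 else k - 1)"
  have r: "r < m" "Suc r mod m = k" "s < m"
    using k m by (auto simp: r_def s_def)
  have r_unique: "j = r" if "j < m" "Suc j mod m = k" for j
    using that m by (auto simp: r_def mod_Suc split: if_splits)
  \<comment> \<open>This needs \<open>3 \<le> m\<close>: for \<open>m = 2\<close> predecessor and
    successor coincide.\<close>
  have "r \<noteq> s"
    using k m by (auto simp: r_def s_def mod_Suc)
  then have "c r \<noteq> c s"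
    using c_eq r by simp
  moreover have "{w. (v, w) \<in> arcs_ends C} = {c r, c s}"
  proof -
    have "(v, w) \<in> arcs_ends C \<longleftrightarrow> w = c s \<or> w = c r" for w
    proof
      assume "(v, w) \<in> arcs_ends C"
      then consider j where "j < m" "v = c j" "w = c (Suc j mod m)"
        | j where "j < m" "w = c j" "v = c (Suc j mod m)"
        unfolding A P by auto
      then show "w = c s \<or> w = c r"
      proof cases
        case 1
        then show ?thesis using c_eq k s_def by auto
      next
        case 2
        then have "Suc j mod m = k"
          using c_eq[of k "Suc j mod m"] k by auto
        then show ?thesis using r_unique 2 by auto
      qed
    next
      assume "w = c s \<or> w = c r"
      then show "(v, w) \<in> arcs_ends C"
        unfolding A P using k r by (force simp: s_def)
    qed
    then show ?thesis by auto
  qed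
  ultimately show "\<exists>a b. a \<noteq> b \<and> {w. (v, w) \<in> arcs_ends C} = {a, b}"
    by blast
qed

section \<open>The graph\<close>

text \<open>
  \<open>pt i j\<close> is the point of the unordered pair \<open>{i, j}\<close> (with \<open>i = j\<close> allowed), \<open>cn i j\<close> the connector
  between \<open>pt i j\<close> and \<open>pt i (j + 1 mod n)\<close> on the i-th cycle.
\<close>

definition pt :: "nat \<Rightarrow> nat \<Rightarrow> nat" where
  "pt i j = 2 * prod_encode (min i j, max i j)"

definition cn :: "nat \<Rightarrow> nat \<Rightarrow> nat" where
  "cn i j = 2 * prod_encode (i, j) + 1"

lemma pt_eq_iff: "pt i j = pt a b \<longleftrightarrow> {i, j} = {a, b}"
  by (auto simp: pt_def doubleton_eq_iff min_def max_def)

lemma cn_eq_iff [simp]: "cn i j = cn a b \<longleftrightarrow> i = a \<and> j = b"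
  by (simp add: cn_def)

text \<open>Points are even and connectors odd.\<close>

lemma pt_neq_cn [simp]: "pt i j \<noteq> cn a b" "cn a b \<noteq> pt i j"
  unfolding pt_def cn_def by presburger+

lemma pt_commute: "pt i j = pt j i"
  by (simp add: pt_eq_iff insert_commute)

lemma pt_left_cancel [simp]: "pt i j = pt i k \<longleftrightarrow> j = k"
  by (auto simp: pt_eq_iff doubleton_eq_iff)

text \<open>Oriented from connector to point; \<open>adj\<close> symmetrises it. Arguments about
  links then need only one direction.\<close>

definition link :: "nat \<Rightarrow> nat \<Rightarrow> nat \<Rightarrow> bool" where
  "link n u v \<longleftrightarrow> (\<exists>i<n. \<exists>j<n. u = cn i j \<and> v \<in> {pt i j, pt i (Suc j mod n)})"

definition adj :: "nat \<Rightarrow> nat \<Rightarrow> nat \<Rightarrow> bool" where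
  "adj n u v \<longleftrightarrow> link n u v \<or> link n v u \<or>
     (\<exists>i<n. \<exists>j<n. \<exists>i'<n. \<exists>j'<n. i \<noteq> i' \<and> u = cn i j \<and> v = cn i' j')"

text \<open>The vertex set of the \<open>i\<close>-th chosen cycle. For distinct
  \<open>i, a < n\<close> the rows of \<open>i\<close> and \<open>a\<close> meet exactly in
  \<open>pt i a\<close>.\<close>

definition row :: "nat \<Rightarrow> nat \<Rightarrow> nat set" where
  "row n i = pt i ` {..<n} \<union> cn i ` {..<n}"

text \<open>Arcs are the pairs of their ends, so parallel arcs cannot occur and
  \<open>arcs_ends\<close> is just \<open>adj\<close>.\<close>

definition row_graph :: "nat \<Rightarrow> (nat, nat \<times> nat) pre_digraph" where
  "row_graph n = \<lparr>verts = (\<Union>i<n. row n i), arcs = {(u, v). adj n u v}, tail = fst, head = snd\<rparr>"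

lemma adj_sym: "adj n u v \<Longrightarrow> adj n v u"
  unfolding adj_def by blast

lemma adj_irrefl: "\<not> adj n u u"
  by (auto simp: adj_def link_def)

lemma adj_cn_cn: "adj n (cn i j) (cn i' j') \<longleftrightarrow> i < n \<and> j < n \<and> i' < n \<and> j' < n \<and> i \<noteq> i'"
  by (auto simp: adj_def link_def)

lemma adj_cn_pt:
  "adj n (cn i j) (pt a b) \<longleftrightarrow> i < n \<and> j < n \<and> (pt a b = pt i j \<or> pt a b = pt i (Suc j mod n))"
  by (auto simp: adj_def link_def)

lemma not_adj_pt_pt: "\<not> adj n (pt i j) (pt a b)"
  by (auto simp: adj_def link_def)

lemma adj_in_rows: "adj n u v \<Longrightarrow> u \<in> (\<Union>i<n. row n i)"
  by (force simp: adj_def link_def row_def)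

lemma in_rows_cases:
  assumes "v \<in> (\<Union>i<n. row n i)"
  obtains i j where "i < n" "j < n" "v = pt i j" | i j where "i < n" "j < n" "v = cn i j"
  using assms by (auto simp: row_def)

lemma arcs_ends_row_graph: "arcs_ends (row_graph n) = {(u, v). adj n u v}"
  by (simp add: arcs_ends_conv row_graph_def)

lemma graph_row_graph: "graph (row_graph n)"
proof -
  have fin: "finite (\<Union>i<n. row n i)" by (simp add: row_def)
  have sub: "{(u, v). adj n u v} \<subseteq> (\<Union>i<n. row n i) \<times> (\<Union>i<n. row n i)"
  proof (rule subrelI)
    fix u v assume "(u, v) \<in> {(u, v). adj n u v}"
    then have "adj n u v" by simp
    then show "(u, v) \<in> (\<Union>i<n. row n i) \<times> (\<Union>i<n. row n i)"
      using adj_in_rows[of n u v] adj_in_rows[of n v u] adj_sym[of n u v] by simp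
  qed
  show ?thesis
  proof unfold_locales
    show "finite (verts (row_graph n))" using fin by (simp add: row_graph_def)
    show "finite (arcs (row_graph n))"
      using finite_subset[OF sub] fin by (simp add: row_graph_def)
    show "symmetric (row_graph n)"
      unfolding symmetric_def arcs_ends_row_graph by (rule symI, simp, rule adj_sym)
  next
    fix e assume "e \<in> arcs (row_graph n)"
    then show "tail (row_graph n) e \<in> verts (row_graph n)"
        "head (row_graph n) e \<in> verts (row_graph n)"
        "tail (row_graph n) e \<noteq> head (row_graph n) e"
      using subsetD[OF sub, of e] adj_irrefl by (auto simp: row_graph_def)
  qed (simp add: row_graph_def arc_to_ends_def)
qed

lemma arcs_ends_induce:
  "arcs_ends (G \<restriction> S) = arcs_ends G \<inter> S \<times> S"
  by (auto simp: arcs_ends_conv)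

lemma graph_induced_subgraph:
  assumes "graph G" "induced_subgraph H G"
  shows "graph H"
proof -
  interpret graph G by fact
  have "digraph H" using assms(2) by (rule digraphI_induced)
  moreover have "symmetric H" using sym_arcs assms(2) by (rule induced_graph_imp_symmetric)
  ultimately show ?thesis by (rule digraph.graphI)
qed

section \<open>Long induced cycles in the graph\<close>

text \<open>A row has no chords: points are never adjacent, and connectors are adjacent only across
  different rows. Inside a row only the links remain, and they form a cycle of length
  \<open>2 * n\<close>.\<close>

lemma row_long_induced_cycle:
  assumes i: "i < n" and n: "2 \<le> n" "l \<le> 2 * n" and T: "row n i \<inter> T = {}"
  shows "long_induced_cycle l (delete_verts (row_graph n) T) (row_graph n \<restriction> row n i)"
proof -
  let ?G = "row_graph n"
  interpret graph ?G by (rule graph_row_graph)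
  have sub: "row n i \<subseteq> verts ?G" using i by (auto simp: row_graph_def)
  have ind: "induced_subgraph (?G \<restriction> row n i) ?G"
    using sub by (rule induced_induce)
  have "induced_subgraph (?G \<restriction> row n i) (delete_verts ?G T)"
  proof -
    interpret D: wf_digraph "delete_verts ?G T"
      unfolding delete_verts_def by (rule wellformed_induce_subgraph)
    have "?G \<restriction> row n i = delete_verts ?G T \<restriction> row n i"
      using sub T by (auto simp: delete_verts_def induce_subgraph_def)
    moreover have "row n i \<subseteq> verts (delete_verts ?G T)"
      using sub T by (auto simp: delete_verts_def)
    ultimately show ?thesis using D.induced_induce by simp
  qed
  moreover have "cycle_graph (2 * n) (?G \<restriction> row n i)"
  proof (rule cycle_graphI)
    define c where "c k = (if even k then pt i (k div 2) else cn i (k div 2))" for k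
    have c_even: "c (2 * j) = pt i j" and c_odd: "c (Suc (2 * j)) = cn i j" for j
      by (simp_all add: c_def)
    \<comment> \<open>The wrap-around from the last connector to the first point, via
      \<open>2 * Suc j mod (2 * n) = 2 * (Suc j mod n)\<close>.\<close>
    have c_next: "c (Suc (Suc (2 * j)) mod (2 * n)) = pt i (Suc j mod n)" if "j < n" for j
      using c_even[of "Suc j mod n"] by (simp add: mult_mod_right)
    have next_even: "Suc (2 * j) mod (2 * n) = Suc (2 * j)" if "j < n" for j
      using that by simp
    have adj: "(u, v) \<in> arcs_ends (?G \<restriction> row n i) \<longleftrightarrow> adj n u v \<and> u \<in> row n i \<and> v \<in> row n i"
      for u v by (simp add: arcs_ends_induce arcs_ends_row_graph)
    have half: "(\<exists>j<n. k = 2 * j) \<or> (\<exists>j<n. k = Suc (2 * j))" if "k < 2 * n" for k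
      using that by presburger
    show "graph (?G \<restriction> row n i)"
      using graph_row_graph ind by (rule graph_induced_subgraph)
    show "3 \<le> 2 * n" using n by simp
    show "inj_on c {..<2 * n}"
      by (rule inj_onI) (auto dest!: half simp: c_even c_odd)
    show "verts (?G \<restriction> row n i) = c ` {..<2 * n}"
    proof -
      have "c ` {..<2 * n} \<subseteq> row n i"
        by (auto dest!: half simp: c_even c_odd row_def)
      moreover have "row n i \<subseteq> c ` {..<2 * n}"
      proof -
        have "pt i j \<in> c ` {..<2 * n}" "cn i j \<in> c ` {..<2 * n}" if "j < n" for j
          using that imageI[of "2 * j" "{..<2 * n}" c] imageI[of "Suc (2 * j)" "{..<2 * n}" c]
          by (simp_all add: c_even c_odd)
        then show ?thesis by (auto simp: row_def)
      qed
      ultimately show ?thesis by simp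
    qed
    show "(c k, c (Suc k mod (2 * n))) \<in> arcs_ends (?G \<restriction> row n i)" if "k < 2 * n" for k
      using half[OF that]
    proof (elim disjE exE conjE)
      fix j assume "j < n" "k = 2 * j"
      then show ?thesis
        using i adj_sym[of n "cn i j" "pt i j"]
        by (auto simp: c_even c_odd next_even adj adj_cn_pt) (auto simp: row_def)
    next
      fix j assume "j < n" "k = Suc (2 * j)"
      then show ?thesis
        using i by (auto simp: c_next c_odd adj adj_cn_pt) (auto simp: row_def)
    qed
    show "\<exists>k<2 * n. {u, v} = {c k, c (Suc k mod (2 * n))}"
      if "(u, v) \<in> arcs_ends (?G \<restriction> row n i)" for u v
    proof -
      have *: "\<exists>k<2 * n. {u, v} = {c k, c (Suc k mod (2 * n))}"
        if link: "link n u v" and u: "u \<in> row n i" for u v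
      proof -
        obtain j where j: "j < n" "u = cn i j" "v = pt i j \<or> v = pt i (Suc j mod n)"
          using link u unfolding link_def row_def by auto
        from j(3) show ?thesis
        proof
          assume "v = pt i j"
          then show ?thesis
            using j by (intro exI[of _ "2 * j"]) (auto simp: c_even c_odd next_even)
        next
          assume "v = pt i (Suc j mod n)"
          then show ?thesis
            using j by (intro exI[of _ "Suc (2 * j)"]) (auto simp: c_odd c_next)
        qed
      qed
      have "link n u v \<or> link n v u"
        using that unfolding adj by (auto simp: adj_def row_def)
      then show ?thesis
        using *[of u v] *[of v u] that unfolding adj by (auto simp: insert_commute)
    qed
  qed
  ultimately show ?thesis
    using n unfolding long_induced_cycle_def by blast
qed

text \<open>Two connectors of different rows would confine \<open>S\<close> to four vertices, so all
  connectors in \<open>S\<close> share one row. Within that row, degree 2 forces \<open>S\<close> to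
  continue from each connector to the next, all the way round.\<close>

lemma two_regular_contains_points:
  assumes S: "S \<subseteq> (\<Union>i<n. row n i)" and big: "5 \<le> card S"
    and reg: "\<And>v. v \<in> S \<Longrightarrow> \<exists>a b. a \<noteq> b \<and> {w \<in> S. adj n v w} = {a, b}"
  shows "\<exists>i<n. pt i ` {..<n} \<subseteq> S"
proof -
  have nbrs: thesis
    if "v \<in> S" "\<And>a b. \<lbrakk>a \<noteq> b; a \<in> S; b \<in> S; \<And>w. w \<in> S \<Longrightarrow> adj n v w \<longleftrightarrow> w = a \<or> w = b\<rbrakk> \<Longrightarrow> thesis"
    for v thesis
    using reg[OF that(1)] that(2) by (smt (verit) insert_iff mem_Collect_eq singletonD)
  have other: thesis
    if "v \<in> S" "w \<in> S" "adj n v w"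
      "\<And>z. \<lbrakk>z \<noteq> w; z \<in> S; \<And>u. u \<in> S \<Longrightarrow> adj n v u \<longleftrightarrow> u = w \<or> u = z\<rbrakk> \<Longrightarrow> thesis"
    for v w thesis
    by (rule nbrs[OF that(1)]) (metis that(2-4))
  have same_row: "i = a" if xS: "cn i j \<in> S" and yS: "cn a b \<in> S" for i j a b
  proof (rule ccontr)
    assume "i \<noteq> a"
    have bounds: "i' < n \<and> j' < n" if "cn i' j' \<in> S" for i' j'
      using S that by (auto simp: row_def)
    define x where "x = cn i j"
    define y where "y = cn a b"
    have xy: "adj n x y" "x \<in> S" "y \<in> S"
      using \<open>i \<noteq> a\<close> xS yS bounds by (auto simp: x_def y_def adj_cn_cn)
    obtain x' where x': "x' \<noteq> y" "x' \<in> S" "\<And>u. u \<in> S \<Longrightarrow> adj n x u \<longleftrightarrow> u = y \<or> u = x'"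
      using other[of x y] xy by blast
    obtain y' where y': "y' \<noteq> x" "y' \<in> S" "\<And>u. u \<in> S \<Longrightarrow> adj n y u \<longleftrightarrow> u = x \<or> u = y'"
      using other[of y x] xy adj_sym by blast
    \<comment> \<open>A connector cannot lie in the rows of both \<open>x\<close> and
      \<open>y\<close>, so it is adjacent to one of them and hence is one of the listed
      neighbours.\<close>
    have row_cn: "cn c d \<in> {x, y, x', y'}" if "cn c d \<in> S" for c d
      using x'(3)[OF that] y'(3)[OF that] bounds[OF that] bounds[OF xS] bounds[OF yS] \<open>i \<noteq> a\<close>
      by (auto simp: x_def y_def adj_cn_cn)
    have "S \<subseteq> {x, y, x', y'}"
    proof
      fix v assume v: "v \<in> S"
      then have "v \<in> (\<Union>i<n. row n i)" using S by blast
      then show "v \<in> {x, y, x', y'}"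
      proof (cases rule: in_rows_cases)
        case (2 c d)
        then show ?thesis using row_cn v by blast
      next
        case (1 c d)
        show ?thesis
        proof (rule ccontr)
          \<comment> \<open>Such a point \<open>v\<close> has two connector neighbours among the
            four vertices. Neither is \<open>x\<close> or \<open>y\<close>, whose neighbours in
            \<open>S\<close> are already known, so they are \<open>x'\<close> and
            \<open>y'\<close>.\<close>
          assume notin: "v \<notin> {x, y, x', y'}"
          obtain r s where rs: "r \<noteq> s" "r \<in> S" "s \<in> S" "adj n v r" "adj n v s"
            using v by (rule nbrs) blast
          have cn: "\<exists>e f. w = cn e f" if "w \<in> S" "adj n v w" for w
          proof -
            have "w \<in> (\<Union>i<n. row n i)" using S that by blast
            then show ?thesis
              by (cases rule: in_rows_cases) (use that 1 not_adj_pt_pt in auto)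
          qed
          have "w \<noteq> x" "w \<noteq> y" if "adj n v w" for w
            using that x'(3)[OF v] y'(3)[OF v] notin adj_sym by blast+
          moreover have "r \<in> {x, y, x', y'}" "s \<in> {x, y, x', y'}"
            using row_cn cn rs by metis+
          ultimately have "{r, s} = {x', y'}" "x' \<noteq> y'"
            using rs by auto
          then have v': "adj n x' v" "adj n y' v"
            using rs adj_sym by (metis doubleton_eq_iff)+
          obtain e f g h where ef: "x' = cn e f" and gh: "y' = cn g h"
            using cn v' x' y' adj_sym by meson
          have x'x: "adj n x' x" and y'y: "adj n y' y"
            using x' y' adj_sym by blast+
          have "\<not> adj n x' w" if "w \<in> S" "w \<noteq> x" "w \<noteq> v" for w
            using other[OF x'(2) xy(2) x'x] v v' notin that by (metis insert_iff)
          then have nx: "\<not> adj n x' y" "\<not> adj n x' y'"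
            using xy y' notin adj_irrefl by (metis insertCI)+
          have "\<not> adj n y' w" if "w \<in> S" "w \<noteq> y" "w \<noteq> v" for w
            using other[OF y'(2) xy(3) y'y] v v' notin that by (metis insert_iff)
          then have ny: "\<not> adj n y' x"
            using xy notin adj_irrefl by (metis insertCI)
          \<comment> \<open>The neighbours of \<open>x'\<close> in \<open>S\<close> are
            \<open>x\<close> and \<open>v\<close>, those of \<open>y'\<close> are \<open>y\<close>
            and \<open>v\<close>. Non-adjacent connectors share a row, so \<open>x'\<close> lies in
            the row of \<open>y\<close>, \<open>y'\<close> in the row of \<open>x\<close>, and
            \<open>x'\<close> in the row of \<open>y'\<close>; this contradicts
            \<open>i \<noteq> a\<close>.\<close>
          show False
            using nx ny \<open>i \<noteq> a\<close> bounds xS yS x'(2) y'(2) unfolding x_def y_def ef gh adj_cn_cn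
            by metis
        qed
      qed
    qed
    then have "card S \<le> card {x, y, x', y'}"
      by (intro card_mono) auto
    also have "\<dots> \<le> 4"
      by (simp add: card_insert_if)
    finally show False using big by simp
  qed
  obtain i j where ij: "i < n" "j < n" "cn i j \<in> S"
  proof -
    obtain v where v: "v \<in> S" using big by fastforce
    then obtain w where w: "w \<in> S" "adj n v w" using nbrs by metis
    have "v \<in> (\<Union>i<n. row n i)" "w \<in> (\<Union>i<n. row n i)" using S v w by auto
    then show ?thesis
      using v w not_adj_pt_pt that by (elim in_rows_cases) metis+
  qed
  have only_pt: "\<exists>a b. w = pt a b" if "w \<in> S" "adj n (cn i k) w" for k w
  proof -
    have "w \<in> (\<Union>i<n. row n i)" using S that by blast
    then show ?thesis
      by (cases rule: in_rows_cases) (use same_row ij that adj_cn_cn in metis)+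
  qed
  \<comment> \<open>With the other rows excluded, only the two linked points can be neighbours of a
    connector, and degree 2 requires both.\<close>
  have cn_pt: "pt i k \<in> S \<and> pt i (Suc k mod n) \<in> S" if k: "cn i k \<in> S" for k
  proof -
    obtain a b where ab: "a \<noteq> b" "a \<in> S" "b \<in> S" "adj n (cn i k) a" "adj n (cn i k) b"
      using k by (rule nbrs) blast
    then have "a \<in> {pt i k, pt i (Suc k mod n)}" "b \<in> {pt i k, pt i (Suc k mod n)}"
      using only_pt[of a k] only_pt[of b k] by (auto simp: adj_cn_pt)
    then show ?thesis using ab by auto
  qed
  have pt_cn: "cn i (Suc k mod n) \<in> S" if k: "cn i k \<in> S" for k
  proof -
    define k' where "k' = Suc k mod n"
    have kn: "k < n" "k' < n" using S k ij by (auto simp: row_def k'_def)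
    have "pt i k' \<in> S" using cn_pt k by (simp add: k'_def)
    then obtain a b where ab: "a \<noteq> b" "a \<in> S" "b \<in> S" "adj n (pt i k') a" "adj n (pt i k') b"
      by (rule nbrs) blast
    \<comment> \<open>The point \<open>pt i k'\<close> is also linked to connectors of row
      \<open>k'\<close>; \<open>same_row\<close> keeps those out of \<open>S\<close> when
      \<open>k' \<noteq> i\<close>.\<close>
    have nbr: "w \<in> {cn i k, cn i k'}" if w: "w \<in> S" "adj n (pt i k') w" for w
    proof -
      have "w \<in> (\<Union>i<n. row n i)" using S w by blast
      then show ?thesis
      proof (cases rule: in_rows_cases)
        case (1 a b)
        then show ?thesis using w not_adj_pt_pt by blast
      next
        case (2 a b)
        then have "a = i" using same_row ij w by blast
        then have "k' = b \<or> k' = Suc b mod n"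
          using adj_sym[OF w(2)] 2 by (simp add: adj_cn_pt)
        then have "b = k' \<or> b = k"
          using kn 2 by (auto simp: k'_def mod_Suc split: if_splits)
        then show ?thesis using 2 \<open>a = i\<close> by blast
      qed
    qed
    then show ?thesis using ab nbr[of a] nbr[of b] by (auto simp: k'_def)
  qed
  have all: "cn i ((j + d) mod n) \<in> S" for d
  proof (induction d)
    case 0
    then show ?case using ij by simp
  next
    case (Suc d)
    then show ?case using pt_cn[OF Suc] by (simp add: mod_Suc_eq)
  qed
  \<comment> \<open>The offset \<open>k + n - j\<close> leads from \<open>j\<close> to
    \<open>k\<close> modulo \<open>n\<close>; adding \<open>n\<close> keeps the subtraction from
    truncating.\<close>
  have "pt i k \<in> S" if "k < n" for k
    using cn_pt[OF all[of "k + n - j"]] that ij by simp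
  then show ?thesis using ij by blast
qed

text \<open>Enough to make any two long induced cycles meet: the point sets of rows \<open>i\<close>
  and \<open>j\<close> both contain \<open>pt i j\<close>, also when \<open>i = j\<close>.\<close>

lemma long_induced_cycle_contains_points:
  assumes C: "long_induced_cycle l (row_graph n) C" and l: "5 \<le> l"
  shows "\<exists>i<n. pt i ` {..<n} \<subseteq> verts C"
proof (rule two_regular_contains_points)
  obtain m where ind: "induced_subgraph C (row_graph n)" and m: "l \<le> m" "cycle_graph m C"
    using C unfolding long_induced_cycle_def by blast
  show sub: "verts C \<subseteq> (\<Union>i<n. row n i)"
    using ind by (auto simp: induced_subgraph_def subgraph_def row_graph_def)
  show "5 \<le> card (verts C)"
    using cycle_graph_two_regular(1)[OF m(2)] m l by simp
  \<comment> \<open>Inducedness enters here: degrees in \<open>C\<close> become degrees with respect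
    to \<open>adj\<close> within \<open>verts C\<close>.\<close>
  have "(u, v) \<in> arcs_ends C \<longleftrightarrow> u \<in> verts C \<and> v \<in> verts C \<and> adj n u v" for u v
    using ind by (auto simp: induced_subgraph_def subgraph_def compatible_def row_graph_def
        arcs_ends_conv image_iff)
  then have "{w \<in> verts C. adj n v w} = {w. (v, w) \<in> arcs_ends C}" if "v \<in> verts C" for v
    using that by blast
  then show "\<exists>a b. a \<noteq> b \<and> {w \<in> verts C. adj n v w} = {a, b}" if "v \<in> verts C" for v
    using cycle_graph_two_regular(2)[OF m(2) that] that by simp
qed

section \<open>Lower bound for hitting sets\<close>

lemma rows_through_vertex:
  assumes "v \<in> (\<Union>i<n. row n i)"
  shows "\<exists>a b. {i. v \<in> row n i} \<subseteq> {a, b}"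
  using assms
proof (cases rule: in_rows_cases)
  case (1 a b)
  then have "{i. v \<in> row n i} \<subseteq> {a, b}"
    by (auto simp: row_def pt_eq_iff doubleton_eq_iff)
  then show ?thesis by blast
next
  case (2 a b)
  then have "{i. v \<in> row n i} \<subseteq> {a, a}"
    by (auto simp: row_def)
  then show ?thesis by blast
qed

text \<open>Double counting: each vertex of \<open>T\<close> meets at most two rows, so
  \<open>T\<close> meets at most \<open>2 * card T\<close> of the \<open>n\<close> rows.\<close>

lemma row_avoiding:
  assumes T: "T \<subseteq> (\<Union>i<n. row n i)" and small: "2 * card T < n"
  shows "\<exists>i<n. row n i \<inter> T = {}"
proof (rule ccontr)
  assume "\<not> ?thesis"
  then have sub: "{..<n} \<subseteq> (\<Union>t\<in>T. {i. t \<in> row n i})" by blast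
  have fin: "finite T"
    using T by (rule finite_subset) (simp add: row_def)
  have at_most_two: "finite {i. t \<in> row n i} \<and> card {i. t \<in> row n i} \<le> 2" if t: "t \<in> T" for t
  proof -
    obtain a b where "{i. t \<in> row n i} \<subseteq> {a, b}"
      using rows_through_vertex[of t n] t T by blast
    then show ?thesis
      using card_mono[of "{a, b}" "{i. t \<in> row n i}"]
      by (auto simp: card_insert_if finite_subset split: if_splits)
  qed
  have "n \<le> card (\<Union>t\<in>T. {i. t \<in> row n i})"
    using card_mono[OF _ sub] fin at_most_two by simp
  also have "\<dots> \<le> (\<Sum>t\<in>T. card {i. t \<in> row n i})"
    by (rule card_UN_le[OF fin])
  also have "\<dots> \<le> (\<Sum>t\<in>T. 2)"
    using at_most_two by (intro sum_mono) blast
  finally show False using small by simp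
qed

theorem theorem1p2:
  fixes l :: nat
  assumes "5 \<le> l"
  shows "\<not> (\<exists>f :: nat \<Rightarrow> nat.
    \<forall>(G :: (nat, nat \<times> nat) pre_digraph) (k :: nat). graph G \<longrightarrow> 0 < k \<longrightarrow>
      (\<exists>F. card F = k + 1 \<and> (\<forall>C\<in>F. long_induced_cycle l G C) \<and>
           (\<forall>C\<in>F. \<forall>D\<in>F. C \<noteq> D \<longrightarrow> verts C \<inter> verts D = {})) \<or>
      (\<exists>T. T \<subseteq> verts G \<and> card T \<le> f k \<and>
           \<not> (\<exists>C. long_induced_cycle l (delete_verts G T) C)))"
proof (rule notI, elim exE)
  fix f :: "nat \<Rightarrow> nat"
  assume f: "\<forall>(G :: (nat, nat \<times> nat) pre_digraph) (k :: nat). graph G \<longrightarrow> 0 < k \<longrightarrow>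
      (\<exists>F. card F = k + 1 \<and> (\<forall>C\<in>F. long_induced_cycle l G C) \<and>
           (\<forall>C\<in>F. \<forall>D\<in>F. C \<noteq> D \<longrightarrow> verts C \<inter> verts D = {})) \<or>
      (\<exists>T. T \<subseteq> verts G \<and> card T \<le> f k \<and>
           \<not> (\<exists>C. long_induced_cycle l (delete_verts G T) C))"
  \<comment> \<open>Chosen so that \<open>2 * f 1 < n\<close>, which leaves a row untouched by any
    \<open>T\<close> with \<open>card T \<le> f 1\<close>, and so that
    \<open>l \<le> 2 * n\<close>.\<close>
  define n where "n = 2 * f 1 + l + 1"
  consider F where "card F = Suc 1" "\<forall>C\<in>F. long_induced_cycle l (row_graph n) C"
      "\<forall>C\<in>F. \<forall>D\<in>F. C \<noteq> D \<longrightarrow> verts C \<inter> verts D = {}"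
    | T where "T \<subseteq> verts (row_graph n)" "card T \<le> f 1"
      "\<not> (\<exists>C. long_induced_cycle l (delete_verts (row_graph n) T) C)"
    using f[rule_format, OF graph_row_graph[of n] zero_less_one] by auto
  then show False
  proof cases
    case 1
    then obtain C D where CD: "C \<in> F" "D \<in> F" "C \<noteq> D"
      by (metis One_nat_def card_2_iff insertCI numeral_2_eq_2)
    obtain i j where "i < n" "pt i ` {..<n} \<subseteq> verts C" "j < n" "pt j ` {..<n} \<subseteq> verts D"
      using long_induced_cycle_contains_points 1 CD assms by meson
    \<comment> \<open>The case \<open>i = j\<close>, where both cycles follow the same row, is
      covered as well.\<close>
    then have "pt i j \<in> verts C \<inter> verts D"
      using pt_commute[of i j] by auto
    then show False using 1 CD by blast
  next
    case 2
    then obtain i where "i < n" "row n i \<inter> T = {}"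
      using row_avoiding[of T n] by (auto simp: row_graph_def n_def)
    then have "long_induced_cycle l (delete_verts (row_graph n) T) (row_graph n \<restriction> row n i)"
      using assms by (intro row_long_induced_cycle) (auto simp: n_def)
    then show False using 2 by blast
  qed
qed

end
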